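(* Let $G$ be a connected infinite graph with a finite maximum degree $\Delta$. Then $\chi_D(G)\leq 2\Delta-1$, where $\chi_D(G)$ is the distinguishing chromatic number of $G$.
   Context: Graphs are simple and undirected; a graph is infinite if it has infinitely many vertices. The distinguishing chromatic number $\chi_D(G)$ is the minimum number of colours in a proper vertex colouring $c$ of $G$ (adjacent vertices receive distinct colours) that is preserved only by the trivial automorphism, where an automorphism $\varphi$ preserves $c$ if $c(\varphi(v))=c(v)$ for all vertices $v$. *)

theory Defs
  imports
    "Graph_Theory.Pair_Digraph"
    "Graph_Theory.Digraph_Component"
    "Graph_Theory.Digraph_Isomorphism"
    "HOL-Library.Extended_Nat"
begin

text \<open>
  A simple undirected graph, possibly infinite, is a \<^locale>\<open>pair_bidirected_digraph\<close>: an
  irreflexive symmetric relation on the vertex set. Each edge is stored as two opposite arcs,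
  so the degree of a vertex is its out-degree.
\<close>

text \<open>
  Finiteness of \<^term>\<open>out_arcs\<close> is required separately because \<^const>\<open>out_degree\<close> is a
  cardinality and hence \<open>0\<close> at vertices of infinite degree.
\<close>

definition has_max_degree :: "'a pair_pre_digraph \<Rightarrow> nat \<Rightarrow> bool" where
  "has_max_degree G d \<longleftrightarrow>
     (\<forall>v \<in> pverts G. finite (out_arcs (with_proj G) v) \<and> out_degree (with_proj G) v \<le> d) \<and>
     (\<exists>v \<in> pverts G. out_degree (with_proj G) v = d)"

definition graph_automorphism :: "'a pair_pre_digraph \<Rightarrow> ('a \<Rightarrow> 'a) \<Rightarrow> bool" where
  "graph_automorphism G f \<longleftrightarrow>
     bij_betw f (pverts G) (pverts G) \<and>
     (\<forall>u \<in> pverts G. \<forall>v \<in> pverts G. (u, v) \<in> parcs G \<longleftrightarrow> (f u, f v) \<in> parcs G)"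

definition proper_vertex_colouring :: "'a pair_pre_digraph \<Rightarrow> ('a \<Rightarrow> 'c) \<Rightarrow> bool" where
  "proper_vertex_colouring G c \<longleftrightarrow> (\<forall>(u, v) \<in> parcs G. c u \<noteq> c v)"

definition preserves_colouring ::
    "'a pair_pre_digraph \<Rightarrow> ('a \<Rightarrow> 'a) \<Rightarrow> ('a \<Rightarrow> 'c) \<Rightarrow> bool" where
  "preserves_colouring G f c \<longleftrightarrow> (\<forall>v \<in> pverts G. c (f v) = c v)"

definition distinguishing_colouring :: "'a pair_pre_digraph \<Rightarrow> ('a \<Rightarrow> 'c) \<Rightarrow> bool" where
  "distinguishing_colouring G c \<longleftrightarrow>
     (\<forall>f. graph_automorphism G f \<longrightarrow> preserves_colouring G f c \<longrightarrow> (\<forall>v \<in> pverts G. f v = v))"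

text \<open>
  Only colourings with finitely many colours are counted, so natural numbers suffice as colours.
  If there is no such colouring, the infimum is that of the empty set, namely \<open>\<infinity>\<close>; otherwise
  it is attained.
\<close>

definition distinguishing_chromatic_number :: "'a pair_pre_digraph \<Rightarrow> enat" where
  "distinguishing_chromatic_number G =
     Inf {enat (card (c ` pverts G)) | c :: 'a \<Rightarrow> nat.
            finite (c ` pverts G) \<and> proper_vertex_colouring G c \<and> distinguishing_colouring G c}"

text \<open>The vertex maps above are those of the library's isomorphisms from a graph to itself.\<close>

lemma graph_automorphism_iff_digraph_isomorphism:
  assumes "pair_wf_digraph G"
  shows "graph_automorphism G f \<longleftrightarrow>
    (\<exists>h. pre_digraph.digraph_isomorphism (with_proj G) h \<and>
         app_iso h (with_proj G) = with_proj G \<and> iso_verts h = f)"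
proof
  interpret pair_wf_digraph G by fact
  assume aut: "graph_automorphism G f"
  then have inj: "inj_on f (pverts G)" and img: "f ` pverts G = pverts G"
    and arc_iff: "\<And>u v. u \<in> pverts G \<Longrightarrow> v \<in> pverts G \<Longrightarrow>
      (u, v) \<in> parcs G \<longleftrightarrow> (f u, f v) \<in> parcs G"
    by (auto simp: graph_automorphism_def bij_betw_def)
  let ?h = "\<lparr>iso_verts = f, iso_arcs = map_prod f f, iso_head = snd, iso_tail = fst\<rparr>"
  have arcs: "map_prod f f ` parcs G = parcs G"
  proof
    show "map_prod f f ` parcs G \<subseteq> parcs G"
    proof
      fix e assume "e \<in> map_prod f f ` parcs G"
      then obtain u v where "(u, v) \<in> parcs G" "e = (f u, f v)" by auto
      then show "e \<in> parcs G" using arc_iff[of u v] wellformed'[of u v] by blast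
    qed
    show "parcs G \<subseteq> map_prod f f ` parcs G"
    proof
      fix e assume e: "e \<in> parcs G"
      then obtain x y where xy: "e = (x, y)" "x \<in> pverts G" "y \<in> pverts G"
        using wellformed' by (cases e) auto
      then obtain u v where uv: "x = f u" "y = f v" "u \<in> pverts G" "v \<in> pverts G"
        using img by blast
      then have "(u, v) \<in> parcs G" using arc_iff[of u v] e xy by blast
      then show "e \<in> map_prod f f ` parcs G" using xy uv by force
    qed
  qed
  have inj_arcs: "inj_on (map_prod f f) (parcs G)"
  proof (rule inj_onI)
    fix d e assume d: "d \<in> parcs G" and e: "e \<in> parcs G" and eq: "map_prod f f d = map_prod f f e"
    have "fst d = fst e" "snd d = snd e"
      using eq inj_onD[OF inj] arc_fst_in_verts[OF d] arc_fst_in_verts[OF e]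
        arc_snd_in_verts[OF d] arc_snd_in_verts[OF e]
      by (metis fst_map_prod, metis snd_map_prod)
    then show "d = e" by (simp add: prod_eq_iff)
  qed
  have "pre_digraph.digraph_isomorphism (with_proj G) ?h"
    unfolding pre_digraph.digraph_isomorphism_def
    using wf_digraph inj inj_arcs by auto
  moreover have "app_iso ?h (with_proj G) = with_proj G"
    using img arcs by (auto simp: app_iso_def with_proj_def)
  ultimately show "\<exists>h. pre_digraph.digraph_isomorphism (with_proj G) h \<and>
      app_iso h (with_proj G) = with_proj G \<and> iso_verts h = f"
    by (intro exI[of _ ?h]) simp
next
  interpret pair_wf_digraph G by fact
  assume "\<exists>h. pre_digraph.digraph_isomorphism (with_proj G) h \<and>
      app_iso h (with_proj G) = with_proj G \<and> iso_verts h = f"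
  then obtain h where h: "pre_digraph.digraph_isomorphism (with_proj G) h"
    and app: "app_iso h (with_proj G) = with_proj G" and f: "iso_verts h = f" by blast
  have img: "f ` pverts G = pverts G" and arcs: "iso_arcs h ` parcs G = parcs G"
    and ends: "iso_tail h = fst" "iso_head h = snd"
    using app f by (auto simp: app_iso_def with_proj_def)
  have inj: "inj_on f (pverts G)"
    using h f by (simp add: pre_digraph.digraph_isomorphism_def)
  have map: "iso_arcs h e = (f (fst e), f (snd e))" if "e \<in> parcs G" for e
    using h f ends that
    by (auto simp: pre_digraph.digraph_isomorphism_def prod_eq_iff)
  have "(u, v) \<in> parcs G \<longleftrightarrow> (f u, f v) \<in> parcs G"
    if "u \<in> pverts G" "v \<in> pverts G" for u v
  proof
    assume "(u, v) \<in> parcs G"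
    then show "(f u, f v) \<in> parcs G" using arcs map[of "(u, v)"] by force
  next
    assume "(f u, f v) \<in> parcs G"
    then obtain e where e: "e \<in> parcs G" "iso_arcs h e = (f u, f v)"
      using arcs by (metis imageE)
    then have "f (fst e) = f u" "f (snd e) = f v" using map by auto
    then have "fst e = u" "snd e = v"
      using inj_onD[OF inj] that arc_fst_in_verts[OF e(1)] arc_snd_in_verts[OF e(1)] by blast+
    then show "(u, v) \<in> parcs G" using e by auto
  qed
  then show "graph_automorphism G f"
    using inj img by (auto simp: graph_automorphism_def bij_betw_def)
qed

end

theory Submission
  imports Defs
begin

text \<open>
  Colour a geodesic ray \<open>0, 1, 0, 1, \<dots>\<close>, and give every other vertex a parent that is nearer
  to the ray. Colour the vertices off the ray greedily along a well-order, avoiding the colours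
  of neighbours and siblings and using \<open>0\<close> only when \<open>1, \<dots>, 2\<Delta> - 2\<close> are all blocked. A vertex has
  at most \<open>\<Delta>\<close> neighbours and \<open>\<Delta> - 2\<close> siblings, so a blocked vertex has neighbours of pairwise distinct
  colours, whereas an inner ray vertex of colour \<open>0\<close> has two neighbours of colour \<open>1\<close>. Hence a
  colour-preserving automorphism preserves the set of even inner ray vertices, up to the endpoint
  of the ray. The ray being geodesic, it fixes this set pointwise, then the whole ray, and then all
  vertices by induction on the distance from the ray: vertices with the same lower neighbours have
  the same parent, and siblings have distinct colours.
\<close>

section \<open>Isometries of sets of naturals, and walks as relation powers\<close>

text \<open>Such a map is a translation or a reflection. A reflection is impossible on a set
  unbounded above, and the least element excludes a proper translation.\<close>

lemma isometry_infinite_nat_set_eq_id: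
  fixes g :: "nat \<Rightarrow> nat"
  assumes inf: "infinite I" and bij: "bij_betw g I I"
    and dist: "\<And>i j. i \<in> I \<Longrightarrow> j \<in> I \<Longrightarrow> \<bar>int (g i) - int (g j)\<bar> = \<bar>int i - int j\<bar>"
    and i: "i \<in> I"
  shows "g i = i"
proof -
  define m where "m = (LEAST k. k \<in> I)"
  have m: "m \<in> I" and least: "\<And>k. k \<in> I \<Longrightarrow> m \<le> k"
    unfolding m_def using i by (auto intro: LeastI Least_le)
  have gI: "\<And>k. k \<in> I \<Longrightarrow> g k \<in> I" using bij by (auto simp: bij_betw_def)
  obtain a where a: "a \<in> I" "g a = m" using bij m by (metis bij_betw_def imageE)
  \<comment> \<open>The distance from \<open>m\<close> to \<open>a\<close> forces
    \<open>g m = a\<close>; a point this far out shows that \<open>m\<close> and \<open>a\<close>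
    cannot be swapped unless they are equal.\<close>
  obtain b where b: "b \<in> I" "b > a + g m" using inf by (meson infinite_nat_iff_unbounded)
  have "g m = m"
    using dist[OF a(1) m] dist[OF b(1) m] dist[OF b(1) a(1)] a(2) b
      least[OF a(1)] least[OF b(1)] least[OF gI[OF m]] least[OF gI[OF b(1)]] by linarith
  then show ?thesis
    using dist[OF i m] least[OF i] least[OF gI[OF i]] by linarith
qed

lemma relpow_map:
  assumes "(x, y) \<in> E ^^ n" and "\<And>x y. (x, y) \<in> E \<Longrightarrow> (f x, f y) \<in> E"
  shows "(f x, f y) \<in> E ^^ n"
  using assms(1)
proof (induction n arbitrary: y)
  case (Suc n)
  then show ?case using assms(2) by (meson relpow_Suc_E relpow_Suc_I)
qed simp

lemma relpow_sym: "sym E \<Longrightarrow> (x, y) \<in> E ^^ n \<Longrightarrow> (y, x) \<in> E ^^ n"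
proof (induction n arbitrary: y)
  case (Suc n)
  then show ?case by (meson relpow_Suc_E relpow_Suc_I2 symD)
qed simp

section \<open>Existence of a geodesic ray\<close>

locale bounded_degree_graph =
  fixes V :: "'a set" and E :: "('a \<times> 'a) set" and D :: nat
  assumes edges: "E \<subseteq> V \<times> V"
    and sym: "sym E"
    and no_loop: "(v, v) \<notin> E"
    and finite_nbrs: "finite (E `` {v})"
    and degree_le: "card (E `` {v}) \<le> D"
    and reachable: "u \<in> V \<Longrightarrow> v \<in> V \<Longrightarrow> (u, v) \<in> E\<^sup>*"
begin

text \<open>This is Koenig's lemma for shortest paths from a root: the ray gains one unit of
  distance \<open>d\<close> per step, and a walk of length \<open>n\<close> raises \<open>d\<close>
  by at most \<open>n\<close>.\<close>

lemma geodesic_ray: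
  assumes inf: "infinite V"
  obtains \<rho> :: "nat \<Rightarrow> 'a" where "\<And>i. (\<rho> i, \<rho> (Suc i)) \<in> E"
    and "\<And>i j n. (\<rho> i, \<rho> j) \<in> E ^^ n \<Longrightarrow> j \<le> i + n"
proof -
  obtain r where r: "r \<in> V" using inf infinite_imp_nonempty by blast
  define d where "d v = (LEAST n. (r, v) \<in> E ^^ n)" for v
  have d: "(r, v) \<in> E ^^ d v" if "v \<in> V" for v
    unfolding d_def using reachable[OF r that] by (metis LeastI rtrancl_imp_relpow)
  have d_le: "d v \<le> n" if "(r, v) \<in> E ^^ n" for v n
    unfolding d_def using that by (rule Least_le)
  have d_step: "d y \<le> d x + n" if "x \<in> V" "(x, y) \<in> E ^^ n" for x y n
    using d_le[of y "d x + n"] d[OF that(1)] that(2) by (auto simp: relpow_add)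
  \<comment> \<open>The vertices that some shortest path from \<open>r\<close> reaches through
    \<open>v\<close>. The ray is kept among vertices with infinite cone.\<close>
  define cone where "cone v = {u. \<exists>m. (v, u) \<in> E ^^ m \<and> d u = d v + m}" for v
  have d_r: "d r = 0" using d_le[of r 0] by simp
  have "V \<subseteq> cone r" using d d_r by (auto simp: cone_def)
  then have cone_r: "infinite (cone r)" using inf finite_subset by blast
  have step: "\<exists>w. (v, w) \<in> E \<and> d w = Suc (d v) \<and> infinite (cone w)"
    if v: "v \<in> V" and infv: "infinite (cone v)" for v
  proof (rule ccontr)
    assume none: "\<nexists>w. (v, w) \<in> E \<and> d w = Suc (d v) \<and> infinite (cone w)"
    \<comment> \<open>The first step of a shortest path beyond \<open>v\<close> leads to one of
      finitely many neighbours, so one of their cones must be infinite.\<close>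
    have "cone v \<subseteq> insert v (\<Union>w \<in> {w \<in> E `` {v}. d w = Suc (d v)}. cone w)"
    proof
      fix u assume "u \<in> cone v"
      then obtain m where m: "(v, u) \<in> E ^^ m" "d u = d v + m" by (auto simp: cone_def)
      show "u \<in> insert v (\<Union>w \<in> {w \<in> E `` {v}. d w = Suc (d v)}. cone w)"
      proof (cases m)
        case 0
        then show ?thesis using m by simp
      next
        case (Suc k)
        then obtain w where w: "(v, w) \<in> E" "(w, u) \<in> E ^^ k"
          using m(1) by (metis relpow_Suc_D2)
        have "d w \<le> d v + 1" using d_step[of v w 1] v w by simp
        moreover have "d u \<le> d w + k" using d_step[of w u k] w edges by auto
        ultimately have "d w = Suc (d v)" using m(2) Suc by linarith
        then show ?thesis using w m(2) Suc by (auto simp: cone_def)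
      qed
    qed
    moreover have "finite (insert v (\<Union>w \<in> {w \<in> E `` {v}. d w = Suc (d v)}. cone w))"
    proof -
      have "finite {w \<in> E `` {v}. d w = Suc (d v)}" by (rule finite_subset[OF _ finite_nbrs[of v]]) auto
      then show ?thesis using none by blast
    qed
    ultimately show False using infv finite_subset by blast
  qed
  have "\<exists>\<rho>. \<forall>n. (\<rho> n \<in> V \<and> d (\<rho> n) = n \<and> infinite (cone (\<rho> n))) \<and> (\<rho> n, \<rho> (Suc n)) \<in> E"
  proof (rule dependent_nat_choice)
    show "\<exists>x. x \<in> V \<and> d x = 0 \<and> infinite (cone x)" using r d_r cone_r by blast
    show "\<exists>y. (y \<in> V \<and> d y = Suc n \<and> infinite (cone y)) \<and> (x, y) \<in> E"
      if "x \<in> V \<and> d x = n \<and> infinite (cone x)" for x n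
      using step[of x] that edges by blast
  qed
  then obtain \<rho> where \<rho>: "\<And>n. \<rho> n \<in> V" "\<And>n. d (\<rho> n) = n" "\<And>n. (\<rho> n, \<rho> (Suc n)) \<in> E"
    by blast
  show thesis
  proof (rule that)
    show "j \<le> i + n" if "(\<rho> i, \<rho> j) \<in> E ^^ n" for i j n
      using d_step[OF \<rho>(1) that] \<rho>(2) by simp
  qed (rule \<rho>(3))
qed

end

section \<open>Levels, parents and the number of siblings\<close>

locale graph_with_geodesic_ray = bounded_degree_graph +
  fixes \<rho> :: "nat \<Rightarrow> 'a"
  assumes ray_edge: "(\<rho> i, \<rho> (Suc i)) \<in> E"
    and geodesic: "(\<rho> i, \<rho> j) \<in> E ^^ n \<Longrightarrow> j \<le> i + n"
begin

abbreviation "R \<equiv> range \<rho>"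

text \<open>For vertices of the graph this is the distance to the ray.\<close>

definition lev :: "'a \<Rightarrow> nat" where
  "lev v = (LEAST n. \<exists>i. (\<rho> i, v) \<in> E ^^ n)"

definition lower :: "'a \<Rightarrow> 'a set" where
  "lower v = {p. (v, p) \<in> E \<and> lev p < lev v}"

text \<open>
  The endpoint \<open>\<rho> 0\<close> has only one neighbour on the ray, so it may have one child more than the
  other ray vertices; it is chosen as a parent only when no other ray vertex is available.
\<close>

definition parent :: "'a \<Rightarrow> 'a" where
  "parent v = (SOME p. p \<in> lower v \<and> (lower v \<inter> \<rho> ` {1..} \<noteq> {} \<longrightarrow> p \<in> \<rho> ` {1..}))"

text \<open>Ray vertices are excluded because \<open>lower\<close> is empty there, which makes their
  \<open>parent\<close> an arbitrary value.\<close>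

definition siblings :: "'a \<Rightarrow> 'a set" where
  "siblings v = {u. u \<in> V \<and> u \<notin> R \<and> u \<noteq> v \<and> parent u = parent v}"

lemma ray_in_V: "\<rho> i \<in> V"
  using ray_edge[of i] edges by blast

lemma edge_sym: "(x, y) \<in> E \<Longrightarrow> (y, x) \<in> E"
  using sym by (rule symD)

lemma ray_walk: "(\<rho> i, \<rho> (i + n)) \<in> E ^^ n"
  by (induction n) (auto intro: ray_edge)

lemma ray_adjD: "(\<rho> i, \<rho> j) \<in> E \<Longrightarrow> j = Suc i \<or> i = Suc j"
  using geodesic[of i j 1] geodesic[of j i 1] edge_sym[of "\<rho> i" "\<rho> j"] no_loop[of "\<rho> i"]
  by (cases "i = j") auto

lemma inj_ray: "inj \<rho>"
proof (rule injI)
  fix i j assume "\<rho> i = \<rho> j"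
  then show "i = j" using geodesic[of i j 0] geodesic[of j i 0] by simp
qed

lemma geodesic_abs: "(\<rho> i, \<rho> j) \<in> E ^^ n \<Longrightarrow> \<bar>int i - int j\<bar> \<le> int n"
  using geodesic[of i j n] geodesic[of j i n] relpow_sym[OF sym, of "\<rho> i" "\<rho> j" n] by linarith

lemma lev_walk:
  assumes "v \<in> V"
  obtains i where "(\<rho> i, v) \<in> E ^^ lev v"
proof -
  have "\<exists>n i. (\<rho> i, v) \<in> E ^^ n"
    using reachable[OF ray_in_V assms] rtrancl_imp_relpow by blast
  then have "\<exists>i. (\<rho> i, v) \<in> E ^^ lev v" unfolding lev_def by (rule LeastI_ex)
  then show thesis using that by blast
qed

lemma lev_le: "(\<rho> i, v) \<in> E ^^ n \<Longrightarrow> lev v \<le> n"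
  unfolding lev_def by (rule Least_le) blast

lemma lev_eq_0_iff: "v \<in> V \<Longrightarrow> lev v = 0 \<longleftrightarrow> v \<in> R"
proof
  assume "v \<in> V" "lev v = 0"
  then show "v \<in> R" using lev_walk[of v] by (metis pair_in_Id_conv rangeI relpow.simps(1))
next
  assume "v \<in> R"
  then show "lev v = 0" using lev_le[of _ v 0] by auto
qed

text \<open>The last vertex before \<open>v\<close> on a shortest walk from the ray is one level
  lower.\<close>

lemma lower_nonempty:
  assumes v: "v \<in> V" "v \<notin> R"
  shows "lower v \<noteq> {}"
proof -
  obtain i where i: "(\<rho> i, v) \<in> E ^^ lev v" using lev_walk[OF v(1)] .
  obtain k where k: "lev v = Suc k" using lev_eq_0_iff[OF v(1)] v(2) not0_implies_Suc by blast
  obtain p where p: "(\<rho> i, p) \<in> E ^^ k" "(p, v) \<in> E" using i unfolding k by (rule relpow_Suc_E)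
  then have "p \<in> lower v" using lev_le[OF p(1)] k edge_sym by (auto simp: lower_def)
  then show ?thesis by blast
qed

lemma parent:
  assumes v: "v \<in> V" "v \<notin> R"
  shows "parent v \<in> lower v \<and> (lower v \<inter> \<rho> ` {1..} \<noteq> {} \<longrightarrow> parent v \<in> \<rho> ` {1..})"
  unfolding parent_def by (rule someI_ex) (use lower_nonempty[OF v] in blast)

lemma ray_nbr_in_lower: "v \<in> V \<Longrightarrow> v \<notin> R \<Longrightarrow> (v, \<rho> i) \<in> E \<Longrightarrow> \<rho> i \<in> lower v"
  using lev_eq_0_iff[of v] lev_eq_0_iff[OF ray_in_V, of i] by (auto simp: lower_def)

text \<open>The preference for inner ray vertices in \<open>parent\<close> pays off here: it makes
  the sharper bound \<open>card_siblings_ray\<close> available next to the inner ray.\<close>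

lemma parent_ray:
  assumes "v \<in> V" "v \<notin> R" "(v, \<rho> i) \<in> E" "i \<ge> 1"
  obtains j where "parent v = \<rho> (Suc j)"
proof -
  have "\<rho> i \<in> lower v \<inter> \<rho> ` {1..}" using ray_nbr_in_lower[OF assms(1-3)] assms(4) by simp
  then obtain k where k: "parent v = \<rho> k" "k \<ge> 1" using parent[OF assms(1,2)] by auto
  then show thesis using that[of "k - 1"] by simp
qed

lemma children_subset:
  assumes "v \<in> V" "v \<notin> R"
  shows "insert v (siblings v) \<subseteq> {u. (parent v, u) \<in> E \<and> u \<notin> R \<and> lev (parent v) < lev u}"
proof
  fix u assume "u \<in> insert v (siblings v)"
  then have "u \<in> V" "u \<notin> R" "parent u = parent v" using assms by (auto simp: siblings_def)
  then show "u \<in> {u. (parent v, u) \<in> E \<and> u \<notin> R \<and> lev (parent v) < lev u}"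
    using parent[of u] edge_sym by (auto simp: lower_def)
qed

lemma finite_siblings: "v \<in> V \<Longrightarrow> v \<notin> R \<Longrightarrow> finite (siblings v)"
  by (rule finite_subset[OF _ finite_nbrs[of "parent v"]]) (use children_subset in blast)

text \<open>Among the at most \<open>D\<close> neighbours of the parent are \<open>v\<close>, its
  siblings, and one vertex \<open>w\<close> that is no child: a ray vertex or a lower
  neighbour.\<close>

lemma card_siblings:
  assumes v: "v \<in> V" "v \<notin> R"
  shows "card (siblings v) + 2 \<le> D"
proof -
  let ?p = "parent v"
  have pV: "?p \<in> V" using parent[OF v] edges by (auto simp: lower_def)
  have "\<exists>w. (?p, w) \<in> E \<and> (w \<in> R \<or> lev w < lev ?p)"
  proof (cases "?p \<in> R")
    case True
    then obtain i where "?p = \<rho> i" by blast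
    then show ?thesis using ray_edge[of i] by auto
  next
    case False
    then show ?thesis using lower_nonempty[OF pV] by (auto simp: lower_def)
  qed
  then obtain w where w: "(?p, w) \<in> E" "w \<in> R \<or> lev w < lev ?p" by blast
  have "card (insert w (insert v (siblings v))) = card (siblings v) + 2"
  proof -
    have "w \<notin> insert v (siblings v)" using children_subset[OF v] w by fastforce
    moreover have "v \<notin> siblings v" by (simp add: siblings_def)
    ultimately show ?thesis using finite_siblings[OF v] by simp
  qed
  moreover have "card (insert w (insert v (siblings v))) \<le> card (E `` {?p})"
    by (rule card_mono[OF finite_nbrs]) (use children_subset[OF v] w in auto)
  ultimately show ?thesis using degree_le[of ?p] by linarith
qed

text \<open>An inner ray vertex has two neighbours on the ray, neither of which is a child.\<close>

lemma card_siblings_ray: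
  assumes v: "v \<in> V" "v \<notin> R" and p: "parent v = \<rho> (Suc j)"
  shows "card (siblings v) + 3 \<le> D"
proof -
  have "card (insert (\<rho> j) (insert (\<rho> (Suc (Suc j))) (insert v (siblings v)))) = card (siblings v) + 3"
  proof -
    have "\<rho> j \<notin> insert v (siblings v)" "\<rho> (Suc (Suc j)) \<notin> insert v (siblings v)"
      using v by (auto simp: siblings_def)
    moreover have "\<rho> j \<noteq> \<rho> (Suc (Suc j))" using inj_ray by (auto dest: injD)
    moreover have "v \<notin> siblings v" by (simp add: siblings_def)
    ultimately show ?thesis using finite_siblings[OF v] by simp
  qed
  moreover have "card (insert (\<rho> j) (insert (\<rho> (Suc (Suc j))) (insert v (siblings v))))
      \<le> card (E `` {\<rho> (Suc j)})"
    by (rule card_mono[OF finite_nbrs])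
      (use children_subset[OF v] p ray_edge edge_sym[OF ray_edge] in auto)
  ultimately show ?thesis using degree_le[of "\<rho> (Suc j)"] by linarith
qed

text \<open>This keeps the ray colour \<open>1\<close> within the palette and the truncated
  subtractions in the colour count exact.\<close>

lemma degree_ge_2: "2 \<le> D"
proof -
  have "card {\<rho> 0, \<rho> 2} \<le> card (E `` {\<rho> 1})"
    by (rule card_mono[OF finite_nbrs])
      (use ray_edge[of 1] edge_sym[OF ray_edge[of 0]] in \<open>auto simp: numeral_2_eq_2\<close>)
  moreover have "\<rho> 0 \<noteq> \<rho> 2" using inj_ray by (auto dest: injD)
  ultimately show ?thesis using degree_le[of "\<rho> 1"] by simp
qed

section \<open>The greedy colouring and its properties\<close>

definition conflicts :: "'a \<Rightarrow> 'a set" where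
  "conflicts v = E `` {v} \<union> siblings v"

text \<open>
  Neighbours of \<open>\<rho> i\<close> with \<open>i \<ge> 1\<close> have one sibling less to avoid, since \<open>\<rho> i\<close> has two neighbours on
  the ray. This leaves room to forbid colour \<open>1\<close> there, so that such a vertex cannot be exchanged
  with one on the ray.
\<close>

definition extra :: "'a \<Rightarrow> nat set" where
  "extra v = (if \<exists>i\<ge>1. (v, \<rho> i) \<in> E then {1} else {})"

text \<open>Well-founded recursion along a well-order, in which the precoloured ray counts as
  preceding every other vertex.\<close>

lemma greedy_colouring:
  obtains c :: "'a \<Rightarrow> nat" and r :: "('a \<times> 'a) set" where
    "\<And>x y. x \<noteq> y \<Longrightarrow> (x, y) \<in> r \<or> (y, x) \<in> r"
    "\<And>i. c (\<rho> i) = i mod 2"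
    "\<And>v. v \<notin> R \<Longrightarrow>
      let F = c ` {u \<in> conflicts v. u \<in> R \<or> (u, v) \<in> r} \<union> extra v
      in c v \<in> {1..2 * D - 2} - F \<or> c v = 0 \<and> {1..2 * D - 2} \<subseteq> F"
proof -
  obtain s :: "'a rel" where s: "well_order_on UNIV s" using well_order_on by blast
  define r where "r = s - Id"
  have wf: "wf r" using s by (simp add: r_def well_order_on_def)
  have total: "(x, y) \<in> r \<or> (y, x) \<in> r" if "x \<noteq> y" for x y
    using s that by (auto simp: r_def well_order_on_def linear_order_on_def total_on_def)
  define ray_col where "ray_col v = inv \<rho> v mod 2" for v
  \<comment> \<open>In the recursion \<open>f\<close> is cut to the predecessors of
    \<open>v\<close>. A ray vertex may come later in \<open>r\<close>, so its colour is read from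
    \<open>ray_col\<close> instead.\<close>
  define F where "F f v = (\<lambda>u. if u \<in> R then ray_col u else f u) `
      {u \<in> conflicts v. u \<in> R \<or> (u, v) \<in> r} \<union> extra v" for f :: "'a \<Rightarrow> nat" and v
  define H where "H f v = (if v \<in> R then ray_col v
      else if \<exists>k. k \<in> {1..2 * D - 2} - F f v then SOME k. k \<in> {1..2 * D - 2} - F f v else 0)" for f v
  define c where "c = wfrec r H"
  have c_eq: "c v = H (cut c r v) v" for v
    unfolding c_def using wf by (rule wfrec)
  have c_ray: "c u = ray_col u" if "u \<in> R" for u
    using that by (simp add: c_eq H_def)
  have F_eq: "F (cut c r v) v = c ` {u \<in> conflicts v. u \<in> R \<or> (u, v) \<in> r} \<union> extra v" for v
    unfolding F_def by (rule arg_cong[where f = "\<lambda>A. A \<union> extra v"], rule image_cong)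
      (auto simp: c_ray cut_apply)
  show thesis
  proof (rule that[of r c])
    show "c (\<rho> i) = i mod 2" for i
      by (simp add: c_ray ray_col_def inv_f_f[OF inj_ray])
    show "let F = c ` {u \<in> conflicts v. u \<in> R \<or> (u, v) \<in> r} \<union> extra v
      in c v \<in> {1..2 * D - 2} - F \<or> c v = 0 \<and> {1..2 * D - 2} \<subseteq> F" if "v \<notin> R" for v
    proof (cases "\<exists>k. k \<in> {1..2 * D - 2} - F (cut c r v) v")
      case True
      then have "c v = (SOME k. k \<in> {1..2 * D - 2} - F (cut c r v) v)"
        unfolding c_eq[of v] H_def using that by simp
      then show ?thesis using someI_ex[OF True] by (simp add: F_eq Let_def)
    next
      case False
      then have "c v = 0" unfolding c_eq[of v] H_def if_not_P[OF that] by (rule if_not_P)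
      then show ?thesis using False by (auto simp: F_eq Let_def)
    qed
  qed (rule total)
qed

lemma special_colouring:
  obtains c :: "'a \<Rightarrow> nat" where
    "\<And>v. v \<in> V \<Longrightarrow> c v \<le> 2 * D - 2"
    "\<And>i. c (\<rho> i) = i mod 2"
    "\<And>u v. (u, v) \<in> E \<Longrightarrow> c u \<noteq> c v"
    "\<And>u v. v \<in> V \<Longrightarrow> v \<notin> R \<Longrightarrow> u \<in> siblings v \<Longrightarrow> c u \<noteq> c v"
    "\<And>v i. v \<in> V \<Longrightarrow> v \<notin> R \<Longrightarrow> i \<ge> 1 \<Longrightarrow> (v, \<rho> i) \<in> E \<Longrightarrow> c v \<notin> {0, 1}"
    "\<And>v. v \<in> V \<Longrightarrow> v \<notin> R \<Longrightarrow> c v = 0 \<Longrightarrow> inj_on c (E `` {v})"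
proof -
  obtain c r where total: "\<And>x y. x \<noteq> y \<Longrightarrow> (x, y) \<in> r \<or> (y, x) \<in> r"
    and c_ray: "\<And>i. c (\<rho> i) = i mod 2"
    and greedy: "\<And>v. v \<notin> R \<Longrightarrow>
      let F = c ` {u \<in> conflicts v. u \<in> R \<or> (u, v) \<in> r} \<union> extra v
      in c v \<in> {1..2 * D - 2} - F \<or> c v = 0 \<and> {1..2 * D - 2} \<subseteq> F"
    by (rule greedy_colouring, rule that)
  define A where "A v = {u \<in> conflicts v. u \<in> R \<or> (u, v) \<in> r}" for v
  have dich: "c v \<in> {1..2 * D - 2} - (c ` A v \<union> extra v) \<or>
      c v = 0 \<and> {1..2 * D - 2} \<subseteq> c ` A v \<union> extra v" if "v \<notin> R" for v
    using greedy[OF that] by (simp add: Let_def A_def)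
  have finA: "finite (A v)" if "v \<in> V" "v \<notin> R" for v
    by (rule finite_subset[of _ "conflicts v"])
      (use finite_nbrs[of v] finite_siblings[OF that] in \<open>auto simp: A_def conflicts_def\<close>)
  have c_ray_01: "c u \<in> {0, 1}" if "u \<in> R" for u
    using that c_ray by auto
  have near_ray: "c v \<notin> {0, 1}"
    if v: "v \<in> V" "v \<notin> R" and i: "i \<ge> 1" "(v, \<rho> i) \<in> E" for v i
  proof -
    obtain j where j: "parent v = \<rho> (Suc j)" using parent_ray[OF v i(2,1)] .
    have pE: "parent v \<in> E `` {v}" using parent[OF v] by (simp add: lower_def)
    \<comment> \<open>The parent is left out because its colour is \<open>0\<close> or the already
      forbidden \<open>1\<close>. At most \<open>(D - 1) + (D - 3) + 1\<close> colours are then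
      blocked, one less than \<open>2 * D - 2\<close>.\<close>
    let ?S = "(E `` {v} - {parent v}) \<union> siblings v"
    have fS: "finite ?S" using finite_nbrs finite_siblings[OF v] by blast
    have "card ?S \<le> card (E `` {v} - {parent v}) + card (siblings v)" by (rule card_Un_le)
    also have "card (E `` {v} - {parent v}) = card (E `` {v}) - 1"
      using pE by (rule card_Diff_singleton)
    finally have "card ?S + 1 < 2 * D - 2"
      using card_siblings_ray[OF v j] degree_le[of v] by linarith
    moreover have "card (insert 1 (c ` ?S)) \<le> card ?S + 1"
      using card_insert_le_m1[of "card ?S + 1" "c ` ?S" 1] card_image_le[OF fS, of c] by simp
    ultimately have "card (insert 1 (c ` ?S)) < card {1..2 * D - 2}" by simp
    then have "\<not> {1..2 * D - 2} \<subseteq> insert 1 (c ` ?S)"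
      using card_mono[of "insert 1 (c ` ?S)" "{1..2 * D - 2}"] fS by auto
    then obtain k where k: "k \<in> {1..2 * D - 2}" "k \<notin> insert 1 (c ` ?S)" by blast
    have "(c ` A v \<union> extra v) \<inter> {1..} \<subseteq> insert 1 (c ` ?S)"
      using c_ray_01[of "parent v"] j by (auto simp: A_def conflicts_def extra_def)
    moreover have "k \<in> {1..}" using k(1) by simp
    ultimately have "k \<notin> c ` A v \<union> extra v" using k(2) by blast
    then have "c v \<in> {1..2 * D - 2} - (c ` A v \<union> extra v)" using dich[OF v(2)] k(1) by blast
    moreover have "1 \<in> extra v" using i by (auto simp: extra_def)
    ultimately have "c v \<ge> 1" "c v \<noteq> 1" by (simp, metis DiffD2 UnI2)
    then show ?thesis by simp
  qed
  \<comment> \<open>Colour \<open>0\<close> means that all \<open>2 * D - 2\<close> positive colours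
    occur on \<open>A v\<close>, while there are at most \<open>D + (D - 2)\<close> conflicts.
    Equality holds throughout, so each positive colour occurs exactly once.\<close>
  have stuck: "inj_on c (conflicts v) \<and> A v = conflicts v \<and> 0 \<notin> c ` A v"
    if v: "v \<in> V" "v \<notin> R" and 0: "c v = 0" for v
  proof -
    have "extra v = {}" using near_ray[OF v] 0 by (auto simp: extra_def)
    then have sub: "{1..2 * D - 2} \<subseteq> c ` A v" using dich[OF v(2)] 0 by auto
    have fC: "finite (conflicts v)"
      using finite_nbrs finite_siblings[OF v] by (simp add: conflicts_def)
    have AC: "A v \<subseteq> conflicts v" by (auto simp: A_def)
    have "card (conflicts v) \<le> card (E `` {v}) + card (siblings v)"
      unfolding conflicts_def by (rule card_Un_le)
    then have C: "card (conflicts v) \<le> 2 * D - 2"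
      using card_siblings[OF v] degree_le[of v] by linarith
    have I: "2 * D - 2 \<le> card (c ` A v)"
      using card_mono[OF _ sub] finA[OF v] by simp
    have cA: "card (c ` A v) \<le> card (A v)" using finA[OF v] by (rule card_image_le)
    have mono: "card (A v) \<le> card (conflicts v)" using fC AC by (rule card_mono)
    have eq: "A v = conflicts v" using card_subset_eq[OF fC AC] C I cA mono by linarith
    have "card (c ` A v) = card (A v)" using C I cA mono by linarith
    then have "inj_on c (A v)" using finA[OF v] by (simp add: eq_card_imp_inj_on)
    moreover have "c ` A v = {1..2 * D - 2}"
      using card_subset_eq[OF _ sub] finA[OF v] C I cA mono by simp
    ultimately show ?thesis using eq by auto
  qed
  have A_neq: "c u \<noteq> c v" if "v \<in> V" "v \<notin> R" "u \<in> A v" for u v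
    using dich[OF that(2)] stuck[OF that(1,2)] that(3) by (metis DiffD2 UnI1 imageI)
  \<comment> \<open>Whichever vertex comes later in \<open>r\<close> has avoided the colour of the
    other.\<close>
  have nonray: "c u \<noteq> c v"
    if "u \<in> V" "u \<notin> R" "v \<in> V" "v \<notin> R" "u \<in> conflicts v" "v \<in> conflicts u" "u \<noteq> v" for u v
    using total[OF that(7)] A_neq[of v u] A_neq[of u v] that by (auto simp: A_def)
  show thesis
  proof (rule that[of c])
    show "c v \<le> 2 * D - 2" if "v \<in> V" for v
    proof (cases "v \<in> R")
      case True
      then show ?thesis using c_ray_01[OF True] degree_ge_2 by auto
    next
      case False
      then show ?thesis using dich[OF False] by auto
    qed
    show "c u \<noteq> c v" if uv: "(u, v) \<in> E" for u v
    proof -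
      have V: "u \<in> V" "v \<in> V" using uv edges by auto
      have vu: "(v, u) \<in> E" using uv by (rule edge_sym)
      have ne: "u \<noteq> v" using uv no_loop by blast
      have conf: "u \<in> conflicts v" "v \<in> conflicts u" using uv vu by (auto simp: conflicts_def)
      consider i j where "u = \<rho> i" "v = \<rho> j" | "u \<in> R" "v \<notin> R" | "u \<notin> R" "v \<in> R"
        | "u \<notin> R" "v \<notin> R" by blast
      then show ?thesis
      proof cases
        case 1
        then show ?thesis using ray_adjD[of i j] uv c_ray mod_Suc[of i 2] mod_Suc[of j 2]
          by (auto split: if_splits)
      next
        case 2
        then have "u \<in> A v" using conf by (simp add: A_def)
        then show ?thesis using A_neq[of v u] V 2 by metis
      next
        case 3
        then have "v \<in> A u" using conf by (simp add: A_def)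
        then show ?thesis using A_neq[of u v] V 3 by metis
      next
        case 4
        then show ?thesis using nonray V conf ne by blast
      qed
    qed
    show "c u \<noteq> c v" if v: "v \<in> V" "v \<notin> R" and u: "u \<in> siblings v" for u v
      using nonray[of u v] v u by (auto simp: conflicts_def siblings_def)
    show "inj_on c (E `` {v})" if v: "v \<in> V" "v \<notin> R" "c v = 0" for v
      using stuck[OF v] by (auto simp: conflicts_def intro: inj_on_subset)
  qed (rule c_ray, rule near_ray)
qed

section \<open>Colour-preserving automorphisms are trivial\<close>

lemma colouring_distinguishing:
  fixes c :: "'a \<Rightarrow> nat"
  assumes c_ray: "\<And>i. c (\<rho> i) = i mod 2"
    and sib: "\<And>u v. v \<in> V \<Longrightarrow> v \<notin> R \<Longrightarrow> u \<in> siblings v \<Longrightarrow> c u \<noteq> c v"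
    and near: "\<And>v i. v \<in> V \<Longrightarrow> v \<notin> R \<Longrightarrow> i \<ge> 1 \<Longrightarrow> (v, \<rho> i) \<in> E \<Longrightarrow> c v \<notin> {0, 1}"
    and zero: "\<And>v. v \<in> V \<Longrightarrow> v \<notin> R \<Longrightarrow> c v = 0 \<Longrightarrow> inj_on c (E `` {v})"
    and bij: "bij_betw f V V"
    and hom: "\<And>u v. u \<in> V \<Longrightarrow> v \<in> V \<Longrightarrow> (f u, f v) \<in> E \<longleftrightarrow> (u, v) \<in> E"
    and pres: "\<And>v. v \<in> V \<Longrightarrow> c (f v) = c v"
    and v: "v \<in> V"
  shows "f v = v"
proof -
  have fV: "f x \<in> V" if "x \<in> V" for x using bij that by (auto simp: bij_betw_def)
  have f_edge: "(f x, f y) \<in> E" if "(x, y) \<in> E" for x y using that hom edges by blast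
  define g where "g = inv_into V f"
  have g: "g x \<in> V" "f (g x) = x" if "x \<in> V" for x
    using bij that unfolding g_def bij_betw_def by (metis inv_into_into, metis f_inv_into_f)
  have gf: "g (f x) = x" if "x \<in> V" for x
    using bij that unfolding g_def bij_betw_def by simp
  have f_inj: "x = y" if "f x = f y" "x \<in> V" "y \<in> V" for x y
    using gf that by metis
  have g_edge: "(g x, g y) \<in> E" if "(x, y) \<in> E" for x y
    using that hom[of "g x" "g y"] g edges by auto
  have f_walk: "(f x, f y) \<in> E ^^ n \<longleftrightarrow> (x, y) \<in> E ^^ n" if "x \<in> V" "y \<in> V" for x y n
    using relpow_map[where E = E and f = f, OF _ f_edge]
      relpow_map[where E = E and f = g, OF _ g_edge] gf that by metis
  \<comment> \<open>Being defined by colours and adjacency alone, \<open>T\<close> is invariant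
    under \<open>f\<close>. Whether \<open>\<rho> 0\<close> belongs to it stays open, so the index
    set \<open>I\<close> below is only known to be infinite.\<close>
  define T where "T = {v \<in> V. c v = 0 \<and> (\<exists>x y. (v, x) \<in> E \<and> (v, y) \<in> E \<and> x \<noteq> y \<and> c x = c y)}"
  have T_I: "v \<in> T" if "c v = 0" "(v, x) \<in> E" "(v, y) \<in> E" "x \<noteq> y" "c x = c y" for v x y
    using that edges by (auto simp: T_def)
  have T_sub: "T \<subseteq> R" using zero by (auto simp: T_def inj_on_def)
  have T_ray: "\<rho> (2 * Suc i) \<in> T" for i
  proof -
    have "(\<rho> (2 * Suc i), \<rho> (2 * i + 1)) \<in> E" "(\<rho> (2 * Suc i), \<rho> (2 * i + 3)) \<in> E"
      using edge_sym[OF ray_edge[of "2 * i + 1"]] ray_edge[of "2 * Suc i"]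
      by (simp_all add: numeral_3_eq_3)
    moreover have "\<rho> (2 * i + 1) \<noteq> \<rho> (2 * i + 3)" using inj_ray by (auto dest: injD)
    moreover have "c (\<rho> (2 * i + 1)) = c (\<rho> (2 * i + 3))" unfolding c_ray by presburger
    moreover have "c (\<rho> (2 * Suc i)) = 0" unfolding c_ray by presburger
    ultimately show ?thesis using T_I by blast
  qed
  have fT: "f ` T = T"
  proof
    show "f ` T \<subseteq> T"
    proof
      fix z assume "z \<in> f ` T"
      then obtain w x y where w: "z = f w" "w \<in> V" "c w = 0"
        "(w, x) \<in> E" "(w, y) \<in> E" "x \<noteq> y" "c x = c y" by (auto simp: T_def)
      then have V: "x \<in> V" "y \<in> V" using edges by auto
      show "z \<in> T"
      proof (rule T_I)
        show "c z = 0" using w pres by simp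
        show "(z, f x) \<in> E" "(z, f y) \<in> E" using w f_edge by simp_all
        show "f x \<noteq> f y" "c (f x) = c (f y)" using w V f_inj pres by metis+
      qed
    qed
    show "T \<subseteq> f ` T"
    proof
      fix z assume "z \<in> T"
      then obtain x y where w: "z \<in> V" "c z = 0"
        "(z, x) \<in> E" "(z, y) \<in> E" "x \<noteq> y" "c x = c y" by (auto simp: T_def)
      then have V: "x \<in> V" "y \<in> V" using edges by auto
      have cg: "c (g u) = c u" if "u \<in> V" for u using pres[of "g u"] g[OF that] by simp
      have "g z \<in> T"
      proof (rule T_I)
        show "c (g z) = 0" using w cg by simp
        show "(g z, g x) \<in> E" "(g z, g y) \<in> E" using w g_edge by simp_all
        show "g x \<noteq> g y" "c (g x) = c (g y)" using w V g cg by metis+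
      qed
      then show "z \<in> f ` T" using g(2)[OF w(1)] by force
    qed
  qed
  define I where "I = {i. \<rho> i \<in> T}"
  define h where "h i = inv \<rho> (f (\<rho> i))" for i
  have h: "\<rho> (h i) = f (\<rho> i)" if "i \<in> I" for i
    unfolding h_def using that fT T_sub by (intro f_inv_into_f) (auto simp: I_def)
  have "infinite I"
  proof (rule infinite_super)
    show "range (\<lambda>i. 2 * Suc i) \<subseteq> I" using T_ray by (auto simp: I_def)
    show "infinite (range (\<lambda>i. 2 * Suc i))" by (rule range_inj_infinite) (simp add: inj_on_def)
  qed
  moreover have "bij_betw h I I"
  proof (rule bij_betwI')
    show "h x = h y \<longleftrightarrow> x = y" if "x \<in> I" "y \<in> I" for x y
      using h that f_inj ray_in_V inj_ray by (metis injD)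
    show "h x \<in> I" if "x \<in> I" for x using h[OF that] that fT by (auto simp: I_def)
    show "\<exists>x\<in>I. y = h x" if "y \<in> I" for y
    proof -
      have "\<rho> y \<in> f ` T" using \<open>y \<in> I\<close> fT by (simp add: I_def)
      then obtain z where z: "z \<in> T" "f z = \<rho> y" by force
      then obtain x where x: "z = \<rho> x" using T_sub by auto
      then have "x \<in> I" using z by (simp add: I_def)
      moreover have "y = h x" using injD[OF inj_ray, of y "h x"] h[OF calculation] z x by simp
      ultimately show ?thesis by blast
    qed
  qed
  moreover have "\<bar>int (h i) - int (h j)\<bar> = \<bar>int i - int j\<bar>" if "i \<in> I" "j \<in> I" for i j
  proof -
    have walk_iff: "(\<rho> a, \<rho> b) \<in> E ^^ n \<longleftrightarrow> (\<rho> (h a), \<rho> (h b)) \<in> E ^^ n"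
      if "a \<in> I" "b \<in> I" for a b n
      using h[OF that(1)] h[OF that(2)] f_walk ray_in_V by metis
    have dist: "(\<rho> a, \<rho> b) \<in> E ^^ nat \<bar>int a - int b\<bar>" for a b
      using ray_walk[of a "b - a"] relpow_sym[OF sym ray_walk[of b "a - b"]]
      by (cases "a \<le> b") (simp_all add: abs_if nat_diff_distrib)
    \<comment> \<open>Ray segments are shortest walks; transporting them along \<open>f\<close> in
      both directions gives the two inequalities.\<close>
    show ?thesis
      using geodesic_abs[OF iffD1[OF walk_iff[OF that] dist]]
        geodesic_abs[OF iffD2[OF walk_iff[OF that] dist]] by linarith
  qed
  ultimately have h_id: "h i = i" if "i \<in> I" for i
    using isometry_infinite_nat_set_eq_id that by blast
  have fix_even: "f (\<rho> (2 * Suc i)) = \<rho> (2 * Suc i)" for i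
    using h h_id T_ray[of i] by (metis I_def mem_Collect_eq)
  \<comment> \<open>The image of \<open>\<rho> j\<close> has colour \<open>0\<close> or
    \<open>1\<close> and is adjacent to the inner ray vertex \<open>\<rho> i\<close>; by
    \<open>near\<close> it cannot lie off the ray.\<close>
  have on_ray: "\<exists>k. f (\<rho> j) = \<rho> k \<and> (k = Suc i \<or> i = Suc k) \<and> k mod 2 = j mod 2"
    if i: "f (\<rho> i) = \<rho> i" "i \<ge> 1" and ij: "(\<rho> i, \<rho> j) \<in> E" for i j
  proof -
    have adj: "(\<rho> i, f (\<rho> j)) \<in> E" using f_edge[OF ij] i by simp
    have "c (f (\<rho> j)) \<in> {0, 1}" using pres[OF ray_in_V] c_ray by auto
    then have "f (\<rho> j) \<in> R" using near[OF fV[OF ray_in_V] _ i(2) edge_sym[OF adj]] by blast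
    then obtain k where k: "f (\<rho> j) = \<rho> k" by blast
    moreover have "k mod 2 = j mod 2" using pres[OF ray_in_V, of j] k c_ray by simp
    ultimately show ?thesis using ray_adjD[of i k] adj by auto
  qed
  \<comment> \<open>Both even ray neighbours are fixed, and this vertex is their only common
    neighbour on the ray.\<close>
  have fix_odd: "f (\<rho> (2 * i + 3)) = \<rho> (2 * i + 3)" for i
  proof -
    obtain k where "f (\<rho> (2 * i + 3)) = \<rho> k" "k = Suc (2 * Suc i) \<or> 2 * Suc i = Suc k"
      using on_ray[OF fix_even, of i "2 * i + 3"] ray_edge[of "2 * Suc i"]
      by (auto simp: numeral_3_eq_3)
    moreover obtain l where "f (\<rho> (2 * i + 3)) = \<rho> l"
        "l = Suc (2 * Suc (Suc i)) \<or> 2 * Suc (Suc i) = Suc l"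
      using on_ray[OF fix_even, of "Suc i" "2 * i + 3"] edge_sym[OF ray_edge[of "2 * i + 3"]]
      by (auto simp: numeral_3_eq_3)
    ultimately show ?thesis using injD[OF inj_ray, of k l] by (auto simp: numeral_3_eq_3)
  qed
  \<comment> \<open>Since \<open>\<rho> 0\<close> is not yet known to be fixed, the alternative
    image \<open>\<rho> 3\<close> is excluded by injectivity; \<open>fix0\<close> works the same
    way.\<close>
  have fix1: "f (\<rho> 1) = \<rho> 1"
  proof -
    obtain k where "f (\<rho> 1) = \<rho> k" "k = 3 \<or> k = 1"
      using on_ray[OF fix_even, of 0 1] edge_sym[OF ray_edge[of 1]] by (auto simp: numeral_2_eq_2 numeral_3_eq_3)
    then show ?thesis using fix_odd[of 0] f_inj[of "\<rho> 1" "\<rho> 3"] ray_in_V injD[OF inj_ray, of 1 3]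
      by auto
  qed
  have fix0: "f (\<rho> 0) = \<rho> 0"
  proof -
    obtain k where "f (\<rho> 0) = \<rho> k" "k = 2 \<or> k = 0"
      using on_ray[OF fix1, of 0] edge_sym[OF ray_edge[of 0]] by auto
    then show ?thesis using fix_even[of 0] f_inj[of "\<rho> 0" "\<rho> 2"] ray_in_V injD[OF inj_ray, of 0 2]
      by auto
  qed
  have fix_ray: "f (\<rho> i) = \<rho> i" for i
  proof -
    consider "i = 0" | "i = 1" | k where "i = 2 * Suc k" | k where "i = 2 * k + 3"
    proof -
      have "i = 0 \<or> i = 1 \<or> i = 2 * Suc (i div 2 - 1) \<or> i = 2 * (i div 2 - 1) + 3" by presburger
      then show ?thesis using that by blast
    qed
    then show ?thesis using fix0 fix1 fix_even fix_odd by cases auto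
  qed
  have lev_f: "lev (f x) = lev x" if "x \<in> V" for x
    unfolding lev_def using f_walk[OF ray_in_V that] by (simp add: fix_ray)
  show ?thesis using v
  proof (induction "lev v" arbitrary: v rule: less_induct)
    case less
    show ?case
    proof (cases "v \<in> R")
      case True
      then show ?thesis using fix_ray by auto
    next
      case False
      have fvR: "f v \<notin> R" using False lev_f less.prems lev_eq_0_iff fV by metis
      have fixed: "f p = p" if "p \<in> V" "lev p < lev v" for p using less.hyps that by blast
      have "(f v, p) \<in> E \<longleftrightarrow> (v, p) \<in> E" if "p \<in> V" "lev p < lev v" for p
        using hom[OF less.prems that(1)] fixed[OF that] by simp
      then have "lower (f v) = lower v"
        unfolding lower_def lev_f[OF less.prems] using edges by blast
      \<comment> \<open>The choice in \<open>parent\<close> depends on the vertex only through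
        \<open>lower\<close>, so equal sets give the same parent.\<close>
      then have "parent (f v) = parent v" by (simp add: parent_def)
      then show ?thesis
        using sib[OF less.prems False, of "f v"] pres[OF less.prems] fvR fV[OF less.prems]
        by (auto simp: siblings_def)
    qed
  qed
qed

end

section \<open>Transfer to the library's graphs\<close>

theorem theorem3:
  fixes G :: "'a pair_pre_digraph" and \<Delta> :: nat
  assumes "pair_bidirected_digraph G"
    and "connected (with_proj G)"
    and "infinite (pverts G)"
    and "has_max_degree G \<Delta>"
  shows "distinguishing_chromatic_number G \<le> enat (2 * \<Delta> - 1)"
proof -
  interpret pair_bidirected_digraph G by fact
  have out: "out_arcs (with_proj G) v = Pair v ` (parcs G `` {v})" for v
    by (auto simp: out_arcs_def)
  have nbrs: "finite (parcs G `` {v}) \<and> card (parcs G `` {v}) \<le> \<Delta>" for v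
  proof (cases "v \<in> pverts G")
    case True
    then have "finite (Pair v ` (parcs G `` {v}))" "card (Pair v ` (parcs G `` {v})) \<le> \<Delta>"
      using assms(4) unfolding has_max_degree_def out_degree_def out by auto
    then show ?thesis by (simp add: finite_image_iff card_image inj_on_def)
  next
    case False
    \<comment> \<open>The locale bounds degrees at every element of the type, including
      non-vertices.\<close>
    then have "parcs G `` {v} = {}" using wellformed' by blast
    then show ?thesis by simp
  qed
  interpret bounded_degree_graph "pverts G" "parcs G" \<Delta>
  proof
    show "parcs G \<subseteq> pverts G \<times> pverts G" using wellformed' by auto
    show "Relation.sym (parcs G)" using arcs_symmetric by (auto simp: sym_def)
    show "(v, v) \<notin> parcs G" for v using pair_no_loops[of "(v, v)"] by auto
    show "finite (parcs G `` {v})" "card (parcs G `` {v}) \<le> \<Delta>" for v using nbrs by auto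
    show "(u, v) \<in> (parcs G)\<^sup>*" if "u \<in> pverts G" "v \<in> pverts G" for u v
    proof -
      \<comment> \<open>The library's \<open>connected\<close> ignores arc directions; symmetry of
        the arcs turns it into directed reachability.\<close>
      have "u \<rightarrow>\<^sup>*\<^bsub>with_proj G\<^esub> v"
        using symmetric_connected_imp_strongly_connected[OF sym_arcs assms(2)] that by auto
      then show ?thesis using reachable_rtranclI by fastforce
    qed
  qed
  obtain \<rho> where "\<And>i. (\<rho> i, \<rho> (Suc i)) \<in> parcs G"
    and "\<And>i j n. (\<rho> i, \<rho> j) \<in> parcs G ^^ n \<Longrightarrow> j \<le> i + n"
    using geodesic_ray[OF assms(3)] by blast
  then interpret graph_with_geodesic_ray "pverts G" "parcs G" \<Delta> \<rho> by unfold_locales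
  obtain c :: "'a \<Rightarrow> nat" where
    bound: "\<And>v. v \<in> pverts G \<Longrightarrow> c v \<le> 2 * \<Delta> - 2"
    and ray: "\<And>i. c (\<rho> i) = i mod 2"
    and proper: "\<And>u v. (u, v) \<in> parcs G \<Longrightarrow> c u \<noteq> c v"
    and sib: "\<And>u v. v \<in> pverts G \<Longrightarrow> v \<notin> R \<Longrightarrow> u \<in> siblings v \<Longrightarrow> c u \<noteq> c v"
    and near: "\<And>v i. v \<in> pverts G \<Longrightarrow> v \<notin> R \<Longrightarrow> i \<ge> 1 \<Longrightarrow> (v, \<rho> i) \<in> parcs G \<Longrightarrow> c v \<notin> {0, 1}"
    and zero: "\<And>v. v \<in> pverts G \<Longrightarrow> v \<notin> R \<Longrightarrow> c v = 0 \<Longrightarrow> inj_on c (parcs G `` {v})"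
    using special_colouring by blast
  have "proper_vertex_colouring G c"
    using proper by (auto simp: proper_vertex_colouring_def)
  moreover have "f v = v"
    if f: "graph_automorphism G f" "preserves_colouring G f c" and v: "v \<in> pverts G" for f v
  proof (rule colouring_distinguishing[where c = c])
    show "bij_betw f (pverts G) (pverts G)" using f by (simp add: graph_automorphism_def)
    show "(f x, f y) \<in> parcs G \<longleftrightarrow> (x, y) \<in> parcs G" if "x \<in> pverts G" "y \<in> pverts G" for x y
      using f that by (auto simp: graph_automorphism_def)
    show "c (f x) = c x" if "x \<in> pverts G" for x
      using f that by (simp add: preserves_colouring_def)
  qed (fact ray sib near zero v)+
  then have "distinguishing_colouring G c"
    by (simp add: distinguishing_colouring_def)
  moreover have sub: "c ` pverts G \<subseteq> {..2 * \<Delta> - 2}" using bound by auto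
  moreover have "finite (c ` pverts G)" using sub finite_subset by blast
  ultimately have "distinguishing_chromatic_number G \<le> enat (card (c ` pverts G))"
    unfolding distinguishing_chromatic_number_def by (intro Inf_lower) blast
  also have "card (c ` pverts G) \<le> 2 * \<Delta> - 1"
    using card_mono[OF _ sub] degree_ge_2 by simp
  finally show ?thesis by simp
qed

end
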